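(* Let $p$ be a prime and let $G$ be a finite elementary abelian $p$-group (written additively) with exponent $e(G)=p$. Let $D\subseteq G$ be a subset with $|D|=|G|-c\geq c$, let $b\in G$, and let $k$ be an integer with $0\le k\le |D|$. Let $N(D,k,b)$ be the number of $k$-element subsets $S\subseteq D$ such that $\sum_{x\in S}x=b$. Then $$\left| N(D, k, b)-\frac{1}{|G|}\binom{|G|-c}{k}\right|\leq \binom{\frac{|G|-2c}{p}+c+k-1}{k}.$$
   Context: For a real number $x$ and an integer $k\ge 0$, $\binom{x}{k}=\frac{(x)_k}{k!}$ with $(x)_0=1$ and $(x)_k=x(x-1)\cdots(x-k+1)$ for $k\geq 1$. *)

theory Defs
  imports Complex_Main "HOL-Library.Cardinality" "HOL-Computational_Algebra.Primes"
begin

text \<open>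
  A finite abelian group written additively is a type of class
  \<open>{finite, ab_group_add}\<close>. The multiple \<open>n x\<close> is the
  \<open>n\<close>-fold sum of \<open>x\<close>.
\<close>

definition nat_multiple :: "nat \<Rightarrow> 'a::{finite, ab_group_add} \<Rightarrow> 'a" where
  "nat_multiple n x = (\<Sum>i<n. x)"

definition add_order :: "'a::{finite, ab_group_add} \<Rightarrow> nat" where
  "add_order x = (LEAST n. 0 < n \<and> nat_multiple n x = 0)"

definition add_exponent :: "'a::{finite, ab_group_add} itself \<Rightarrow> nat" where
  "add_exponent _ = (LEAST n. 0 < n \<and> (\<forall>x::'a. nat_multiple n x = 0))"

text \<open>
  The trivial group satisfies this definition for every prime \<open>p\<close>; requiring
  in addition that the exponent is \<open>p\<close> excludes it.
\<close>

definition elementary_abelian :: "nat \<Rightarrow> 'a::{finite, ab_group_add} itself \<Rightarrow> bool" where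
  "elementary_abelian p _ \<longleftrightarrow> prime p \<and> (\<forall>x::'a. x \<noteq> 0 \<longrightarrow> add_order x = p)"

definition subset_sum_count :: "'a::{finite, ab_group_add} set \<Rightarrow> nat \<Rightarrow> 'a \<Rightarrow> nat" where
  "subset_sum_count D k b = card {S. S \<subseteq> D \<and> card S = k \<and> (\<Sum>x\<in>S. x) = b}"

end

theory Submission
  imports Defs "HOL-Computational_Algebra.Formal_Power_Series" "HOL-Number_Theory.Cong"
begin

text \<open>
  Averaging over the characters \<open>\<chi>\<close> of \<open>G\<close> gives
  \<open>|G| N(D, k, b) = (\<Sum>\<chi>. \<chi>(-b) e\<^sub>k(\<chi>(D)))\<close>, where \<open>e\<^sub>k(\<chi>(D))\<close> is the elementary
  symmetric sum of the values of \<open>\<chi>\<close> on \<open>D\<close>; the trivial character contributes the main term.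
  For nontrivial \<open>\<chi>\<close> the \<open>i\<close>-th power sum over \<open>D\<close> has modulus at most \<open>c\<close> if \<open>p\<close> does not
  divide \<open>i\<close>, since the sum over \<open>G\<close> vanishes, and at most \<open>|G| - c\<close> otherwise. By Newton's
  identities and induction on \<open>k\<close>, \<open>|e\<^sub>k(\<chi>(D))|\<close> is at most \<open>g\<^sub>k = (M + k - 1 gchoose k)\<close> with
  \<open>M = (|G| - 2c)/p + c \<ge> 1\<close>: since \<open>g\<close> is increasing, its sum over the indices \<open>i < k\<close> in the
  residue class of \<open>k\<close> modulo \<open>p\<close> is at most \<open>1/p\<close> of its sum over all \<open>i < k\<close>, and
  \<open>M (g\<^sub>0 + \<dots> + g\<^sub>k\<^sub>-\<^sub>1) = k g\<^sub>k\<close>.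
\<close>

section \<open>Elementary symmetric sums\<close>

text \<open>The sum runs over subsets of the index set \<open>D\<close>, not over sets of values, so
  repeated values of \<open>u\<close> count with multiplicity.\<close>

definition esym :: "'b set \<Rightarrow> ('b \<Rightarrow> complex) \<Rightarrow> nat \<Rightarrow> complex" where
  "esym D u k = (\<Sum>S | S \<subseteq> D \<and> card S = k. \<Prod>x\<in>S. u x)"

lemma prod_fps_const_X:
  assumes "finite S"
  shows "(\<Prod>x\<in>S. fps_const (u x) * fps_X) = fps_const (\<Prod>x\<in>S. u x :: complex) * fps_X ^ card S"
  using assms by (induction S rule: finite_induct) (simp_all add: mult_ac flip: fps_const_mult)

text \<open>Generating function: expanding the product picks a subset \<open>S\<close> of factors
  contributing their linear term, hence the power \<open>card S\<close> of
  \<open>fps_X\<close>.\<close>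

lemma fps_nth_prod_linear:
  assumes "finite D"
  shows "fps_nth (\<Prod>x\<in>D. 1 + fps_const (u x) * fps_X) k = esym D u k"
proof -
  have fin: "finite S" if "S \<in> Pow D" for S
    using that assms finite_subset by auto
  have "(\<Prod>x\<in>D. fps_const (u x) * fps_X + 1)
      = (\<Sum>S\<in>Pow D. fps_const (\<Prod>x\<in>S. u x) * fps_X ^ card S)"
    by (subst prod_add[OF assms]) (auto intro!: sum.cong simp: prod_fps_const_X fin)
  then have "fps_nth (\<Prod>x\<in>D. 1 + fps_const (u x) * fps_X) k
      = (\<Sum>S\<in>Pow D. if card S = k then \<Prod>x\<in>S. u x else 0)"
    by (auto simp: add.commute fps_sum_nth fps_X_power_iff intro!: sum.cong)
  also have "\<dots> = esym D u k"
    unfolding esym_def using assms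
    by (subst sum.inter_filter[symmetric]) (auto intro!: sum.cong)
  finally show ?thesis .
qed

text \<open>Logarithmic differentiation in multiplied-out form; the series attached to
  \<open>x\<close> is the expansion of \<open>u x / (1 + u x * X)\<close>.\<close>

lemma fps_deriv_prod_linear:
  assumes "finite D"
  shows "fps_deriv (\<Prod>x\<in>D. 1 + fps_const (u x :: complex) * fps_X)
    = (\<Prod>x\<in>D. 1 + fps_const (u x) * fps_X)
      * (\<Sum>x\<in>D. Abs_fps (\<lambda>i. (- 1) ^ i * u x ^ Suc i))"
  using assms
proof (induction D rule: finite_induct)
  case empty
  then show ?case by simp
next
  case (insert y D)
  let ?L = "1 + fps_const (u y) * fps_X"
  let ?Q = "Abs_fps (\<lambda>i. (- 1) ^ i * u y ^ Suc i)"
  have geometric: "?L * ?Q = fps_const (u y)"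
  proof (rule fps_ext)
    fix n
    show "fps_nth (?L * ?Q) n = fps_nth (fps_const (u y)) n"
      by (cases n) (simp_all add: distrib_right mult.assoc)
  qed
  have deriv: "fps_deriv ?L = fps_const (u y)"
    by simp
  let ?E = "\<Prod>x\<in>D. 1 + fps_const (u x) * fps_X"
  let ?P = "\<Sum>x\<in>D. Abs_fps (\<lambda>i. (- 1) ^ i * u x ^ Suc i)"
  have "fps_deriv (?L * ?E) = ?L * (?E * ?P) + (?L * ?Q) * ?E"
    unfolding geometric by (subst fps_deriv_mult) (simp only: insert.IH deriv)
  also have "\<dots> = ?L * ?E * (?Q + ?P)"
    by (simp only: algebra_simps)
  finally show ?case
    using insert.hyps by simp
qed

text \<open>Compare the coefficients of index \<open>k\<close> in the logarithmic derivative
  formula; differentiation produces the factor \<open>Suc k\<close>.\<close>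

lemma newton_identity:
  assumes "finite D"
  shows "of_nat (Suc k) * esym D u (Suc k)
    = (\<Sum>i\<le>k. esym D u i * ((- 1) ^ (k - i) * (\<Sum>x\<in>D. u x ^ Suc (k - i))))"
proof -
  have "fps_nth (\<Sum>x\<in>D. Abs_fps (\<lambda>i. (- 1) ^ i * u x ^ Suc i)) j
      = (- 1) ^ j * (\<Sum>x\<in>D. u x ^ Suc j)" for j
    by (simp add: fps_sum_nth sum_distrib_left)
  then have "fps_nth (fps_deriv (\<Prod>x\<in>D. 1 + fps_const (u x) * fps_X)) k
      = (\<Sum>i\<le>k. esym D u i * ((- 1) ^ (k - i) * (\<Sum>x\<in>D. u x ^ Suc (k - i))))"
    by (simp only: fps_deriv_prod_linear[OF assms] fps_mult_nth fps_nth_prod_linear[OF assms]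
        atLeast0AtMost)
  then show ?thesis
    by (simp add: fps_nth_prod_linear[OF assms])
qed

lemma esym_0: "finite D \<Longrightarrow> esym D u 0 = 1"
proof -
  assume "finite D"
  then have "{S. S \<subseteq> D \<and> card S = 0} = {{}}"
    by (auto dest: finite_subset)
  then show ?thesis
    by (simp add: esym_def)
qed

section \<open>Bounding elementary symmetric sums by power sums\<close>

text \<open>The shifted coefficient is the rising factorial of \<open>M\<close> with
  \<open>m\<close> factors divided by \<open>m!\<close>, so consecutive terms have ratio
  \<open>(M + m) / (m + 1)\<close>.\<close>

lemma gbinomial_shift_recurrence:
  fixes M :: real
  shows "real (Suc m) * ((M + real (Suc m) - 1) gchoose Suc m) = (M + real m) * ((M + real m - 1) gchoose m)"
  by (simp add: gbinomial_pochhammer' pochhammer_Suc field_simps del: of_nat_Suc)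

lemma gbinomial_shift_nonneg:
  fixes M :: real
  assumes "0 \<le> M"
  shows "0 \<le> (M + real m - 1) gchoose m"
  using assms by (simp add: gbinomial_pochhammer' pochhammer_prod prod_nonneg)

text \<open>For \<open>1 \<le> M\<close> the ratio \<open>(M + n) / (n + 1)\<close> of consecutive
  terms is at least 1.\<close>

lemma gbinomial_shift_mono:
  fixes M :: real
  assumes "1 \<le> M" "m \<le> n"
  shows "((M + real m - 1) gchoose m) \<le> ((M + real n - 1) gchoose n)"
proof (rule lift_Suc_mono_le[OF _ assms(2), where f = "\<lambda>m. (M + real m - 1) gchoose m"])
  fix n
  let ?g = "\<lambda>m. (M + real m - 1) gchoose m"
  have "real (Suc n) * ?g n \<le> (M + real n) * ?g n"
    using assms gbinomial_shift_nonneg[of M n] by (intro mult_right_mono) auto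
  also have "\<dots> = real (Suc n) * ?g (Suc n)"
    by (rule gbinomial_shift_recurrence[symmetric])
  finally show "?g n \<le> ?g (Suc n)"
    by (simp del: of_nat_Suc)
qed

text \<open>Adding \<open>M * g m\<close> to \<open>m * g m\<close> gives
  \<open>(M + m) * g m\<close>, which the recurrence turns into
  \<open>(m + 1) * g (m + 1)\<close>.\<close>

lemma gbinomial_shift_sum:
  fixes M :: real
  shows "(\<Sum>i<m. M * ((M + real i - 1) gchoose i)) = real m * ((M + real m - 1) gchoose m)"
proof (induction m)
  case (Suc m)
  then show ?case
    unfolding sum.lessThan_Suc gbinomial_shift_recurrence by (simp add: algebra_simps)
qed simp

text \<open>Blocks of \<open>p\<close> consecutive indices are cut off from the top. Each contains
  one selected index, its smallest, so by monotonicity \<open>p\<close> times that value is at most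
  the block sum.\<close>

lemma sum_residue_le:
  fixes g :: "nat \<Rightarrow> real"
  assumes "0 < p" and nonneg: "\<And>i. 0 \<le> g i" and mono: "\<And>i j. i \<le> j \<Longrightarrow> g i \<le> g j"
  shows "(\<Sum>i<m. if p dvd m - i then real p * g i else 0) \<le> (\<Sum>i<m. g i)"
proof (induction m rule: less_induct)
  case (less m)
  show ?case
  proof (cases "m < p")
    case True
    then have "(\<Sum>i<m. if p dvd m - i then real p * g i else 0) = 0"
      by (intro sum.neutral) (auto dest: dvd_imp_le)
    then show ?thesis
      by (simp add: sum_nonneg nonneg)
  next
    case False
    \<comment> \<open>On the top block from \<open>r\<close> to \<open>m - 1\<close> the difference
      \<open>m - i\<close> runs through \<open>1..p\<close>, so only \<open>i = r\<close> is
      selected.\<close>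
    define r where "r = m - p"
    have m: "m = r + p" and "r < m"
      using False \<open>0 < p\<close> by (auto simp: r_def)
    have split: "{..<m} = {..<r} \<union> {r..<m}"
      using \<open>r < m\<close> by auto
    let ?f = "\<lambda>i. if p dvd m - i then real p * g i else 0"
    have "(\<Sum>i<r. ?f i) = (\<Sum>i<r. if p dvd r - i then real p * g i else 0)"
    proof (intro sum.cong refl)
      fix i assume "i \<in> {..<r}"
      then have "m - i = (r - i) + p"
        by (simp add: m)
      then show "?f i = (if p dvd r - i then real p * g i else 0)"
        by simp
    qed
    also have "\<dots> \<le> (\<Sum>i<r. g i)"
      by (rule less.IH[OF \<open>r < m\<close>])
    finally have low: "(\<Sum>i<r. ?f i) \<le> (\<Sum>i<r. g i)" .
    have "(\<Sum>i=r..<m. ?f i) = (\<Sum>i\<in>{r}. ?f i)"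
      by (rule sum.mono_neutral_right) (use \<open>r < m\<close> in \<open>auto simp: m dest!: dvd_imp_le\<close>)
    also have "\<dots> = (\<Sum>i=r..<m. g r)"
      by (simp add: m)
    also have "\<dots> \<le> (\<Sum>i=r..<m. g i)"
      by (intro sum_mono mono) simp
    finally have "(\<Sum>i=r..<m. ?f i) \<le> (\<Sum>i=r..<m. g i)" .
    with low show ?thesis
      unfolding split by (subst (1 2) sum.union_disjoint) auto
  qed
qed

text \<open>Strong induction through Newton's identity. The extra \<open>p * a\<close> occurs only
  for indices congruent to \<open>k\<close>, so on average it costs \<open>a\<close> per index, and
  the weighted sum of the bounds is at most \<open>k * g k\<close>.\<close>

lemma norm_esym_le:
  fixes c a :: real
  assumes "finite D" "0 < p" "0 \<le> c" "0 \<le> a" "1 \<le> a + c"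
    and powersum: "\<And>i. 0 < i \<Longrightarrow>
      norm (\<Sum>x\<in>D. u x ^ i) \<le> c + (if p dvd i then real p * a else 0)"
  shows "norm (esym D u k) \<le> (a + c + real k - 1) gchoose k"
proof (induction k rule: less_induct)
  case (less k)
  let ?g = "\<lambda>i. (a + c + real i - 1) gchoose i"
  have g_nonneg: "0 \<le> ?g i" for i
    using assms gbinomial_shift_nonneg by simp
  show ?case
  proof (cases k)
    case 0
    then show ?thesis
      using assms by (simp add: esym_0)
  next
    case (Suc m)
    have "real k * norm (esym D u k) = norm (of_nat k * esym D u k)"
      by (simp only: norm_mult norm_of_nat)
    also have "\<dots> \<le> (\<Sum>i\<le>m. norm (esym D u i * ((- 1) ^ (m - i) * (\<Sum>x\<in>D. u x ^ Suc (m - i)))))"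
      unfolding Suc newton_identity[OF assms(1)] by (rule norm_sum)
    also have "\<dots> \<le> (\<Sum>i\<le>m. ?g i * (c + (if p dvd Suc (m - i) then real p * a else 0)))"
    proof (rule sum_mono)
      fix i assume "i \<in> {..m}"
      then have "norm (esym D u i) \<le> ?g i"
        using less.IH[of i] Suc by simp
      moreover have "norm ((- 1) ^ (m - i) * (\<Sum>x\<in>D. u x ^ Suc (m - i)))
          \<le> c + (if p dvd Suc (m - i) then real p * a else 0)"
        using powersum[of "Suc (m - i)"] by (simp only: norm_mult norm_power) simp
      ultimately show "norm (esym D u i * ((- 1) ^ (m - i) * (\<Sum>x\<in>D. u x ^ Suc (m - i))))
          \<le> ?g i * (c + (if p dvd Suc (m - i) then real p * a else 0))"
        unfolding norm_mult[of "esym D u i"] using g_nonneg by (intro mult_mono) auto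
    qed
    also have "\<dots> = (\<Sum>i<k. c * ?g i + a * (if p dvd k - i then real p * ?g i else 0))"
      unfolding Suc lessThan_Suc_atMost
      by (intro sum.cong) (auto simp: Suc_diff_le algebra_simps)
    also have "\<dots> = c * (\<Sum>i<k. ?g i) + a * (\<Sum>i<k. if p dvd k - i then real p * ?g i else 0)"
      by (simp only: sum.distrib sum_distrib_left)
    also have "\<dots> \<le> c * (\<Sum>i<k. ?g i) + a * (\<Sum>i<k. ?g i)"
      using sum_residue_le[OF \<open>0 < p\<close>, of ?g k] g_nonneg gbinomial_shift_mono assms
      by (intro add_left_mono mult_left_mono) auto
    also have "\<dots> = (\<Sum>i<k. (a + c) * ?g i)"
      by (simp add: distrib_right sum.distrib flip: sum_distrib_left)
    also have "\<dots> = real k * ?g k"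
      by (rule gbinomial_shift_sum)
    finally show ?thesis
      using Suc by (simp del: of_nat_Suc)
  qed
qed

section \<open>Characters of elementary abelian groups\<close>

lemma nat_multiple_0 [simp]: "nat_multiple 0 x = 0"
  by (simp add: nat_multiple_def)

lemma nat_multiple_Suc [simp]: "nat_multiple (Suc n) x = nat_multiple n x + x"
  by (simp add: nat_multiple_def)

lemma nat_multiple_zero [simp]: "nat_multiple n 0 = 0"
  by (simp add: nat_multiple_def)

lemma nat_multiple_add: "nat_multiple (m + n) x = nat_multiple m x + nat_multiple n x"
  by (induction n) (simp_all add: add_ac)

lemma nat_multiple_mult: "nat_multiple (m * n) x = nat_multiple m (nat_multiple n x)"
  by (induction m) (simp_all add: nat_multiple_add add_ac)

lemma nat_multiple_add_right: "nat_multiple n (x + y) = nat_multiple n x + nat_multiple n y"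
  by (induction n) (simp_all add: add_ac)

text \<open>Pigeonhole: two multiples of \<open>x\<close> coincide, and their difference shows that
  the \<open>LEAST\<close> ranges over a nonempty set.\<close>

lemma nat_multiple_add_order:
  fixes x :: "'a::{finite, ab_group_add}"
  shows "0 < add_order x \<and> nat_multiple (add_order x) x = 0"
proof -
  have "\<not> inj (\<lambda>n. nat_multiple n x)"
    using finite_imageD[of "\<lambda>n. nat_multiple n x" UNIV] by auto
  then obtain m n where mn: "m < n" "nat_multiple m x = nat_multiple n x"
    unfolding inj_def by (metis linorder_neqE_nat)
  then have "nat_multiple (n - m) x = 0"
    using nat_multiple_add[of m "n - m" x] by simp
  then have "0 < n - m \<and> nat_multiple (n - m) x = 0"
    using mn by simp
  then show ?thesis
    unfolding add_order_def by (rule LeastI)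
qed

lemma nat_multiple_neq_0: "0 < n \<Longrightarrow> n < add_order x \<Longrightarrow> nat_multiple n x \<noteq> 0"
  unfolding add_order_def using not_less_Least by blast

text \<open>The condition at 0 excludes the zero function, which is also multiplicative.\<close>

definition characters :: "('a::ab_group_add \<Rightarrow> complex) set" where
  "characters = {\<chi>. \<chi> 0 = 1 \<and> (\<forall>x y. \<chi> (x + y) = \<chi> x * \<chi> y)}"

lemma character_0: "\<chi> \<in> characters \<Longrightarrow> \<chi> 0 = 1"
  and character_add: "\<chi> \<in> characters \<Longrightarrow> \<chi> (x + y) = \<chi> x * \<chi> y"
  by (auto simp: characters_def)

lemma one_in_characters: "(\<lambda>x. 1) \<in> characters"
  by (simp add: characters_def)

lemma character_mult: "\<chi> \<in> characters \<Longrightarrow> \<psi> \<in> characters \<Longrightarrow> (\<lambda>x. \<chi> x * \<psi> x) \<in> characters"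
  by (simp add: characters_def)

lemma character_power: "\<chi> \<in> characters \<Longrightarrow> (\<lambda>x. \<chi> x ^ i) \<in> characters"
  by (simp add: characters_def power_mult_distrib)

lemma character_sum: "\<chi> \<in> characters \<Longrightarrow> \<chi> (\<Sum>x\<in>S. f x) = (\<Prod>x\<in>S. \<chi> (f x))"
  by (induction S rule: infinite_finite_induct) (simp_all add: character_0 character_add)

lemma character_nat_multiple: "\<chi> \<in> characters \<Longrightarrow> \<chi> (nat_multiple n x) = \<chi> x ^ n"
  by (induction n) (simp_all add: character_0 character_add)

text \<open>Translation by \<open>y\<close> permutes the group but multiplies the sum by
  \<open>\<chi> y\<close>.\<close>

lemma sum_character:
  fixes \<chi> :: "'a::{finite, ab_group_add} \<Rightarrow> complex"
  assumes "\<chi> \<in> characters" "\<chi> y \<noteq> 1"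
  shows "(\<Sum>x\<in>UNIV. \<chi> x) = 0"
proof -
  have "(\<Sum>x\<in>UNIV. \<chi> x) = (\<Sum>x\<in>UNIV. \<chi> (y + x))"
    by (rule sum.reindex_bij_betw[symmetric])
      (auto intro!: bij_betwI[where g = "\<lambda>x. x - y"])
  also have "\<dots> = \<chi> y * (\<Sum>x\<in>UNIV. \<chi> x)"
    using assms by (simp add: character_add sum_distrib_left)
  finally show ?thesis
    using assms(2) by simp
qed

section \<open>Separation and orthogonality of characters in the elementary abelian case\<close>

locale elementary_abelian_group =
  fixes p :: nat and dummy :: "'a::{finite, ab_group_add} itself"
  assumes elementary: "elementary_abelian p dummy"
begin

lemma prime_p: "prime p"
  and add_order_eq: "x \<noteq> 0 \<Longrightarrow> add_order (x :: 'a) = p"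
  using elementary by (auto simp: elementary_abelian_def)

lemma p_pos: "0 < p"
  using prime_p prime_gt_0_nat by blast

lemma nat_multiple_p [simp]: "nat_multiple p (x :: 'a) = 0"
  using nat_multiple_add_order[of x] add_order_eq[of x] by (cases "x = 0") auto

lemma nat_multiple_p_minus_1: "nat_multiple (p - 1) (x :: 'a) = - x"
  using nat_multiple_Suc[of "p - 1" x] p_pos by (simp add: eq_neg_iff_add_eq_0)

text \<open>Take \<open>i\<close> inverse to \<open>j\<close> modulo \<open>p\<close>; the same
  \<open>i\<close> serves all \<open>x\<close>, since \<open>p\<close> annihilates the whole
  group.\<close>

lemma nat_multiple_inverse:
  assumes "\<not> p dvd j"
  obtains i where "\<And>x :: 'a. nat_multiple (i * j) x = x"
proof -
  have "coprime j p"
    using assms prime_p prime_imp_coprime_nat coprime_commute by blast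
  then obtain i where "[j * i = 1] (mod p)"
    using cong_solve_coprime_nat by auto
  then have "(i * j) mod p = 1"
    using prime_gt_1_nat[OF prime_p] by (simp add: cong_def mult.commute)
  then have "i * j = (i * j div p) * p + 1"
    using div_mult_mod_eq[of "i * j" p] by simp
  then obtain q where "i * j = q * p + 1" by blast
  then have "nat_multiple (i * j) x = x" for x :: 'a
    by (simp only: nat_multiple_add nat_multiple_mult[of q]) simp
  then show thesis ..
qed

lemma character_power_p: "\<chi> \<in> characters \<Longrightarrow> \<chi> (x :: 'a) ^ p = 1"
  by (metis character_nat_multiple character_0 nat_multiple_p)

lemma norm_character: "\<chi> \<in> characters \<Longrightarrow> norm (\<chi> (x :: 'a)) = 1"
proof -
  assume "\<chi> \<in> characters"
  then have "norm (\<chi> x) ^ p = 1 ^ p"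
    by (simp add: character_power_p flip: norm_power)
  then show ?thesis
    by (rule power_eq_imp_eq_base) (use p_pos in auto)
qed

lemma finite_characters: "finite (characters :: ('a \<Rightarrow> complex) set)"
proof -
  have "finite {z :: complex. z ^ p = 1}"
    using p_pos by (intro finite_roots_unity) auto
  then have "finite (PiE UNIV (\<lambda>x :: 'a. {z :: complex. z ^ p = 1}))"
    by (intro finite_PiE) auto
  moreover have "characters \<subseteq> PiE UNIV (\<lambda>x :: 'a. {z :: complex. z ^ p = 1})"
    using character_power_p by (auto simp: PiE_def)
  ultimately show ?thesis
    using finite_subset by blast
qed

text \<open>
  For a subgroup \<open>H\<close> maximal with \<open>x \<notin> H\<close>, every element lies in exactly one
  coset \<open>j x + H\<close> with \<open>j\<close> modulo \<open>p\<close>, so \<open>j\<close> determines a character.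
\<close>
lemma character_separates:
  fixes x :: 'a
  assumes "x \<noteq> 0"
  obtains \<chi> :: "'a \<Rightarrow> complex" where "\<chi> \<in> characters" "\<chi> x \<noteq> 1"
proof -
  \<comment> \<open>Closure under negation is automatic, because \<open>- y\<close> is the multiple
    \<open>p - 1\<close> of \<open>y\<close>.\<close>
  define sub where "sub = (\<lambda>H :: 'a set. 0 \<in> H \<and> (\<forall>y\<in>H. \<forall>z\<in>H. y + z \<in> H))"
  have "finite {H. sub H \<and> x \<notin> H}" "{0} \<in> {H. sub H \<and> x \<notin> H}"
    using assms by (auto simp: sub_def)
  then obtain H where H: "sub H" "x \<notin> H"
    and maximal: "\<And>K. sub K \<Longrightarrow> x \<notin> K \<Longrightarrow> H \<subseteq> K \<Longrightarrow> K = H"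
    using finite_has_maximal[of "{H. sub H \<and> x \<notin> H}"] by blast
  have H_add: "y + z \<in> H" if "y \<in> H" "z \<in> H" for y z
    using H(1) that by (auto simp: sub_def)
  have H_mult: "nat_multiple n y \<in> H" if "y \<in> H" for n y
    using H(1) that by (induction n) (auto simp: sub_def)
  have H_minus: "- y \<in> H" if "y \<in> H" for y
    using H_mult[OF that, of "p - 1"] by (simp only: nat_multiple_p_minus_1)
  have H_diff: "y - z \<in> H" if "y \<in> H" "z \<in> H" for y z
    using H_add[OF that(1) H_minus[OF that(2)]] by simp
  \<comment> \<open>Otherwise \<open>j\<close> is invertible modulo \<open>p\<close>, and
    \<open>x\<close> would be a multiple of an element of \<open>H\<close>.\<close>
  have dvd: "p dvd j" if "nat_multiple j x \<in> H" for j
    using nat_multiple_inverse[of j] H_mult[OF that] H(2) by (metis nat_multiple_mult)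
  \<comment> \<open>If no such \<open>j\<close> exists, \<open>y\<close> lies outside
    \<open>H\<close>, so by maximality the subgroup \<open>K\<close> generated by \<open>H\<close>
    and \<open>y\<close> contains \<open>x\<close>; the resulting equation is then solved for
    \<open>y\<close>.\<close>
  have "\<exists>j. y - nat_multiple j x \<in> H" for y
  proof (rule ccontr)
    assume no: "\<nexists>j. y - nat_multiple j x \<in> H"
    define K where "K = {h + nat_multiple j y | h j. h \<in> H}"
    have "sub K"
      unfolding sub_def
    proof (intro conjI ballI)
      show "0 \<in> K"
        using H(1) unfolding K_def sub_def by (metis (mono_tags, lifting) add_0 mem_Collect_eq nat_multiple_0)
    next
      fix u v assume "u \<in> K" "v \<in> K"
      then obtain h j h' j' where "h \<in> H" "h' \<in> H" "u = h + nat_multiple j y" "v = h' + nat_multiple j' y"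
        by (auto simp: K_def)
      then have "u + v = (h + h') + nat_multiple (j + j') y" "h + h' \<in> H"
        by (auto simp: nat_multiple_add add_ac H_add)
      then show "u + v \<in> K"
        unfolding K_def by blast
    qed
    have "H \<subseteq> K"
      by (auto simp: K_def intro!: exI[of _ "0::nat"])
    have "y \<notin> H"
      using no[unfolded not_ex, rule_format, of 0] by simp
    moreover have "y \<in> K"
      using H(1) by (auto simp: K_def sub_def intro!: exI[of _ "0::'a"] exI[of _ "Suc 0"])
    ultimately have "x \<in> K"
      using maximal[OF \<open>sub K\<close> _ \<open>H \<subseteq> K\<close>] by blast
    then obtain h j where h: "h \<in> H" "x = h + nat_multiple j y"
      by (auto simp: K_def)
    show False
    proof (cases "p dvd j")
      case True
      then have "nat_multiple j y = 0"
        by (auto simp: nat_multiple_mult mult.commute[of p])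
      then show False
        using h H(2) by simp
    next
      case False
      then obtain i where i: "\<And>z :: 'a. nat_multiple (i * j) z = z"
        using nat_multiple_inverse by blast
      have "nat_multiple i x = nat_multiple i h + y"
        by (simp add: h(2) nat_multiple_add_right i flip: nat_multiple_mult)
      then have "y - nat_multiple i x = - nat_multiple i h"
        by simp
      then show False
        using no H_minus[OF H_mult[OF h(1)]] by metis
    qed
  qed
  then obtain J where J: "\<And>y. y - nat_multiple (J y) x \<in> H"
    by metis
  define \<zeta> where "\<zeta> = cis (2 * pi / real p)"
  have \<zeta>_p: "\<zeta> ^ p = 1"
    using p_pos by (simp add: \<zeta>_def DeMoivre)
  have \<zeta>_1: "\<zeta> \<noteq> 1"
  proof
    assume "\<zeta> = 1"
    then have "cos (2 * pi / real p) = 1"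
      by (simp add: \<zeta>_def complex_eq_iff)
    then obtain n :: int where "2 * pi / real p = real_of_int n * 2 * pi"
      by (auto simp: cos_one_2pi_int)
    then have "1 = real_of_int n * real p"
      using p_pos by (simp add: field_simps)
    then have "1 = n * int p"
      by (metis of_int_1 of_int_eq_iff of_int_mult of_int_of_nat_eq)
    then show False
      using prime_gt_1_nat[OF prime_p] zmult_eq_1_iff[of n "int p"] by auto
  qed
  \<comment> \<open>Two exponents valid for the same \<open>y\<close> differ by a multiple of
    \<open>p\<close>; the order of \<open>i\<close> and \<open>j\<close> is fixed because the
    subtraction is on naturals.\<close>
  have le: "\<zeta> ^ i = \<zeta> ^ j"
    if "i \<le> j" and "y - nat_multiple i x \<in> H" and "y - nat_multiple j x \<in> H" for i j y
  proof -
    have j: "j = i + (j - i)"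
      using that by simp
    have "nat_multiple (j - i) x = (y - nat_multiple i x) - (y - nat_multiple j x)"
      by (subst (2) j) (simp add: nat_multiple_add del: le_add_diff_inverse)
    then have "p dvd j - i"
      using dvd H_diff that by metis
    then obtain q where "j - i = p * q" ..
    then have "\<zeta> ^ (j - i) = 1"
      by (simp add: power_mult \<zeta>_p)
    then show ?thesis
      by (subst j) (simp add: power_add del: le_add_diff_inverse)
  qed
  have unique: "\<zeta> ^ i = \<zeta> ^ j"
    if "y - nat_multiple i x \<in> H" and "y - nat_multiple j x \<in> H" for i j y
    using le[of i j y] le[of j i y] that by (metis nat_le_linear)
  define \<chi> where "\<chi> = (\<lambda>y. \<zeta> ^ J y)"
  \<comment> \<open>The value does not depend on the choice \<open>J\<close>, so any convenient
    exponent may be used for \<open>0\<close>, \<open>y + z\<close> and \<open>x\<close>.\<close>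
  have \<chi>: "\<chi> y = \<zeta> ^ j" if "y - nat_multiple j x \<in> H" for y j
    unfolding \<chi>_def using unique J that by blast
  have "\<chi> 0 = 1"
    using \<chi>[of 0 0] H(1) by (simp add: sub_def)
  moreover have "\<chi> (y + z) = \<chi> y * \<chi> z" for y z
  proof -
    have "y + z - nat_multiple (J y + J z) x \<in> H"
      using H_add[OF J[of y] J[of z]] by (simp add: nat_multiple_add algebra_simps)
    then have "\<chi> (y + z) = \<zeta> ^ (J y + J z)"
      by (rule \<chi>)
    then show ?thesis
      by (simp add: \<chi>_def power_add)
  qed
  moreover have "\<chi> x = \<zeta>"
    using \<chi>[of x 1] H(1) by (simp add: sub_def)
  ultimately show thesis
    using that[of \<chi>] \<zeta>_1 by (simp add: characters_def)
qed

text \<open>Multiplication by a character \<open>\<psi>\<close> with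
  \<open>\<psi> x \<noteq> 1\<close> permutes the characters, with inverse multiplication by the
  power \<open>p - 1\<close> of \<open>\<psi>\<close>.\<close>

lemma sum_characters_nonzero:
  fixes x :: 'a
  assumes "x \<noteq> 0"
  shows "(\<Sum>\<chi>\<in>characters. \<chi> x) = 0"
proof -
  obtain \<psi> :: "'a \<Rightarrow> complex" where \<psi>: "\<psi> \<in> characters" "\<psi> x \<noteq> 1"
    using character_separates[OF assms] by blast
  have inverse: "\<psi> z ^ (p - 1) * \<psi> z = 1" for z
    using character_power_p[OF \<psi>(1), of z] p_pos by (simp only: power_minus_mult)
  have "(\<Sum>\<chi>\<in>characters. \<chi> x) = (\<Sum>\<chi>\<in>characters. \<psi> x * \<chi> x)"
    by (rule sum.reindex_bij_witness[of _ "\<lambda>\<chi> z. \<psi> z * \<chi> z" "\<lambda>\<chi> z. \<psi> z ^ (p - 1) * \<chi> z"])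
      (use \<psi>(1) inverse in \<open>auto simp: mult.assoc[symmetric] mult.commute[of "\<psi> _" "\<psi> _ ^ _"]
        intro!: character_mult character_power\<close>)
  also have "\<dots> = \<psi> x * (\<Sum>\<chi>\<in>characters. \<chi> x)"
    by (simp add: sum_distrib_left)
  finally show ?thesis
    using \<psi>(2) by simp
qed

text \<open>Double counting of all values \<open>\<chi> x\<close>: summed by elements only
  \<open>x = 0\<close> contributes, summed by characters only the trivial one does.\<close>

lemma card_characters: "card (characters :: ('a \<Rightarrow> complex) set) = CARD('a)"
proof -
  have "of_nat (card (characters :: ('a \<Rightarrow> complex) set))
      = (\<Sum>x\<in>UNIV. if (x :: 'a) = 0 then of_nat (card (characters :: ('a \<Rightarrow> complex) set)) else 0 :: complex)"
    by simp
  also have "\<dots> = (\<Sum>x\<in>UNIV. \<Sum>\<chi>\<in>characters. \<chi> (x :: 'a))"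
    by (intro sum.cong) (auto simp: sum_characters_nonzero character_0)
  also have "\<dots> = (\<Sum>\<chi>\<in>characters. \<Sum>x\<in>UNIV. \<chi> (x :: 'a))"
    by (rule sum.swap)
  also have "\<dots> = (\<Sum>\<chi>\<in>{\<lambda>x. 1}. \<Sum>x\<in>UNIV. \<chi> (x :: 'a))"
    by (rule sum.mono_neutral_right)
      (auto simp: finite_characters one_in_characters fun_eq_iff intro: sum_character)
  also have "\<dots> = of_nat CARD('a)"
    by simp
  finally show ?thesis
    by (simp only: of_nat_eq_iff)
qed

lemma sum_characters: "(\<Sum>\<chi>\<in>characters. \<chi> (x :: 'a)) = (if x = 0 then of_nat CARD('a) else 0)"
  by (simp add: sum_characters_nonzero character_0 card_characters)

text \<open>Summing \<open>\<chi> (- b + \<Sum>S)\<close> over all characters detects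
  \<open>\<Sum>S = b\<close>, and the product of \<open>\<chi>\<close> over \<open>S\<close> equals
  \<open>\<chi> (\<Sum>S)\<close>.\<close>

lemma subset_sum_count_eq:
  fixes D :: "'a set"
  shows "of_nat CARD('a) * of_nat (subset_sum_count D k b)
    = (\<Sum>\<chi>\<in>characters. \<chi> (- b) * esym D \<chi> k)"
proof -
  let ?A = "{S. S \<subseteq> D \<and> card S = k}"
  have "(\<Sum>\<chi>\<in>characters. \<chi> (- b) * esym D \<chi> k)
      = (\<Sum>\<chi>\<in>characters. \<Sum>S\<in>?A. \<chi> (- b + \<Sum>S))"
    by (simp add: esym_def sum_distrib_left character_add character_sum
        del: add_uminus_conv_diff uminus_add_conv_diff)
  also have "\<dots> = (\<Sum>S\<in>?A. \<Sum>\<chi>\<in>characters. \<chi> (- b + \<Sum>S))"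
    by (rule sum.swap)
  also have "\<dots> = (\<Sum>S\<in>?A. if \<Sum>S = b then of_nat CARD('a) else 0)"
    by (intro sum.cong refl) (auto simp: sum_characters neg_eq_iff_add_eq_0)
  also have "\<dots> = of_nat CARD('a) * of_nat (card {S \<in> ?A. \<Sum>S = b})"
    by (subst sum.inter_filter[symmetric]) auto
  also have "{S \<in> ?A. \<Sum>S = b} = {S. S \<subseteq> D \<and> card S = k \<and> (\<Sum>x\<in>S. x) = b}"
    by auto
  finally show ?thesis
    by (simp add: subset_sum_count_def)
qed

text \<open>As \<open>i\<close> is invertible modulo \<open>p\<close>, the power of
  \<open>\<chi>\<close> stays nontrivial and sums to 0 over the group. The sum over \<open>D\<close>
  is thus minus that over the complement, whose terms have modulus 1.\<close>

lemma norm_character_power_sum_le: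
  fixes D :: "'a set"
  assumes "\<chi> \<in> characters" "\<chi> \<noteq> (\<lambda>x. 1)" "\<not> p dvd i"
  shows "norm (\<Sum>x\<in>D. \<chi> x ^ i) \<le> real (card (- D))"
proof -
  obtain y where "\<chi> y \<noteq> 1"
    using assms(2) by auto
  obtain j where j: "\<And>z :: 'a. nat_multiple (j * i) z = z"
    using nat_multiple_inverse[OF assms(3)] by blast
  have "\<chi> y = \<chi> (nat_multiple (j * i) y)"
    by (simp only: j)
  also have "\<dots> = (\<chi> y ^ i) ^ j"
    by (simp add: character_nat_multiple assms(1) power_mult mult.commute[of j])
  finally have "\<chi> y = (\<chi> y ^ i) ^ j" .
  then have "\<chi> y ^ i \<noteq> 1"
    using \<open>\<chi> y \<noteq> 1\<close> by (metis power_one)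
  then have "(\<Sum>x\<in>UNIV. \<chi> x ^ i) = 0"
    by (rule sum_character[OF character_power[OF assms(1)]])
  moreover have "(\<Sum>x\<in>UNIV. \<chi> x ^ i) = (\<Sum>x\<in>D. \<chi> x ^ i) + (\<Sum>x\<in>- D. \<chi> x ^ i)"
    by (subst sum.union_disjoint[symmetric]) (auto simp: Compl_partition)
  ultimately have "(\<Sum>x\<in>D. \<chi> x ^ i) = - (\<Sum>x\<in>- D. \<chi> x ^ i)"
    by (simp add: eq_neg_iff_add_eq_0)
  then have "norm (\<Sum>x\<in>D. \<chi> x ^ i) \<le> (\<Sum>x\<in>- D. norm (\<chi> x ^ i))"
    by (simp add: norm_sum)
  also have "\<dots> = real (card (- D))"
    by (simp add: norm_power norm_character assms(1))
  finally show ?thesis .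
qed

text \<open>The multiples of \<open>x\<close> by \<open>0..p-1\<close> are distinct.\<close>

lemma p_le_card:
  assumes "(x :: 'a) \<noteq> 0"
  shows "p \<le> CARD('a)"
proof -
  have "nat_multiple i x \<noteq> nat_multiple j x" if "i < j" "j < p" for i j
  proof
    assume "nat_multiple i x = nat_multiple j x"
    then have "nat_multiple (j - i) x = 0"
      using nat_multiple_add[of i "j - i" x] that by simp
    then show False
      using nat_multiple_neq_0[of "j - i" x] that by (simp add: add_order_eq[OF assms])
  qed
  then have "inj_on (\<lambda>i. nat_multiple i x) {..<p}"
    unfolding inj_on_def by (metis lessThan_iff linorder_neqE_nat)
  then show ?thesis
    using card_inj_on_le[of "\<lambda>i. nat_multiple i x" "{..<p}" UNIV] by simp
qed

end

section \<open>The trivial character and the final estimate\<close>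

lemma esym_one: "finite D \<Longrightarrow> esym D (\<lambda>x. 1) k = of_nat (card D choose k)"
  by (simp add: esym_def n_subsets)

text \<open>Since a prime is not 1, an exponent \<open>p\<close> forces a nonzero element to
  exist.\<close>

lemma add_exponent_trivial:
  assumes "\<And>x :: 'a::{finite, ab_group_add}. x = 0"
  shows "add_exponent TYPE('a) = 1"
  unfolding add_exponent_def by (rule Least_equality) (use assms in auto)

theorem corollary1p2:
  fixes p c k :: nat
    and D :: "'a::{finite, ab_group_add} set"
    and b :: 'a
  assumes "prime p"
    and "elementary_abelian p TYPE('a)"
    and "add_exponent TYPE('a) = p"
    and "int (card D) = int (CARD('a)) - int c"
    and "c \<le> card D"
    and "k \<le> card D"
  shows "\<bar>real (subset_sum_count D k b) - 1 / real (CARD('a)) * ((real (CARD('a)) - real c) gchoose k)\<bar>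
    \<le> ((real (CARD('a)) - 2 * real c) / real p + real c + real k - 1) gchoose k"
proof -
  interpret elementary_abelian_group p "TYPE('a)"
    by standard (rule assms(2))
  let ?X = "characters :: ('a \<Rightarrow> complex) set"
  define n where "n = CARD('a)"
  \<comment> \<open>Chosen so that \<open>c + p * a\<close> equals \<open>card D\<close>, the
    trivial bound for power sums whose exponent is divisible by \<open>p\<close>.\<close>
  define a where "a = (real n - 2 * real c) / real p"
  define g where "g = (a + real c + real k - 1) gchoose k"
  have cD: "card D + c = n"
    using assms(4) by (simp add: n_def)
  then have cD': "card (- D) = c"
    by (simp add: n_def Compl_eq_Diff_UNIV card_Diff_subset flip: cD)
  have "0 < n"
    by (simp add: n_def)
  have a: "0 \<le> a" "real p * a = real n - 2 * real c"
    using p_pos assms(5) cD by (simp_all add: a_def)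
  obtain x :: 'a where "x \<noteq> 0"
    using add_exponent_trivial[where 'a = 'a] assms(1,3) not_prime_1 by metis
  then have "p \<le> n"
    using p_le_card n_def by blast
  \<comment> \<open>For \<open>c = 0\<close> this amounts to \<open>p \<le> n\<close>; otherwise
    \<open>c\<close> alone is at least 1.\<close>
  have ac: "1 \<le> a + real c"
  proof (cases "c = 0")
    case True
    then show ?thesis
      using \<open>p \<le> n\<close> p_pos by (simp add: a_def)
  next
    case False
    then show ?thesis
      using a by simp
  qed
  have bound: "norm (\<chi> (- b) * esym D \<chi> k) \<le> g" if "\<chi> \<in> ?X - {\<lambda>x. 1}" for \<chi>
  proof -
    have \<chi>: "\<chi> \<in> ?X" "\<chi> \<noteq> (\<lambda>x. 1)"
      using that by auto
    have "norm (\<Sum>x\<in>D. \<chi> x ^ i) \<le> real c + (if p dvd i then real p * a else 0)" for i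
    proof (cases "p dvd i")
      case True
      have "norm (\<Sum>x\<in>D. \<chi> x ^ i) \<le> (\<Sum>x\<in>D. norm (\<chi> x ^ i))"
        by (rule norm_sum)
      also have "\<dots> = real (card D)"
        by (simp add: norm_power norm_character \<chi>)
      also have "\<dots> = real c + real p * a"
        unfolding a(2) using cD by linarith
      finally show ?thesis
        using True by simp
    next
      case False
      then show ?thesis
        using norm_character_power_sum_le[OF \<chi> False, of D] by (simp add: cD')
    qed
    then have "norm (esym D \<chi> k) \<le> g"
      unfolding g_def by (intro norm_esym_le[OF _ p_pos _ a(1) ac]) auto
    then show ?thesis
      by (simp add: norm_mult norm_character \<chi>)
  qed
  have "0 \<le> g"
    unfolding g_def using ac by (intro gbinomial_shift_nonneg) simp
  have main: "(real n - real c) gchoose k = real (card D choose k)"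
    using cD by (simp add: binomial_gbinomial flip: cD)
  have "of_nat n * of_nat (subset_sum_count D k b)
      = (\<Sum>\<chi>\<in>?X. \<chi> (- b) * esym D \<chi> k)"
    unfolding n_def by (rule subset_sum_count_eq)
  \<comment> \<open>The trivial character is split off: all its values are 1, so it counts the
    \<open>k\<close>-subsets of \<open>D\<close>.\<close>
  also have "\<dots> = of_nat (card D choose k) + (\<Sum>\<chi>\<in>?X - {\<lambda>x. 1}. \<chi> (- b) * esym D \<chi> k)"
    by (subst sum.remove[OF finite_characters one_in_characters]) (simp add: esym_one)
  finally have "of_nat n * of_nat (subset_sum_count D k b) - of_nat (card D choose k)
      = (\<Sum>\<chi>\<in>?X - {\<lambda>x. 1}. \<chi> (- b) * esym D \<chi> k)"
    by simp
  then have "norm (of_nat n * of_nat (subset_sum_count D k b) - of_nat (card D choose k) :: complex)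
      \<le> real (card (?X - {\<lambda>x. 1})) * g"
    using bound by (simp only: sum_norm_bound)
  \<comment> \<open>The group has \<open>n\<close> characters, so bounding the number of nontrivial
    ones by \<open>n\<close> lets the factor cancel on division by \<open>n\<close>.\<close>
  also have "\<dots> \<le> real n * g"
    using \<open>0 \<le> g\<close> card_Diff1_le[of ?X "\<lambda>x. 1"] unfolding n_def card_characters
    by (intro mult_right_mono) simp_all
  also have "(of_nat n * of_nat (subset_sum_count D k b) - of_nat (card D choose k) :: complex)
      = of_real (real n * real (subset_sum_count D k b) - real (card D choose k))"
    by simp
  finally have "\<bar>real n * real (subset_sum_count D k b) - real (card D choose k)\<bar> \<le> real n * g"
    by (simp only: norm_of_real)
  also have "real n * real (subset_sum_count D k b) - real (card D choose k)
      = real n * (real (subset_sum_count D k b) - 1 / real n * ((real n - real c) gchoose k))"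
    using \<open>0 < n\<close> by (simp add: main field_simps)
  finally have "\<bar>real (subset_sum_count D k b) - 1 / real n * ((real n - real c) gchoose k)\<bar> \<le> g"
    using \<open>0 < n\<close> by (simp add: abs_mult)
  then show ?thesis
    unfolding g_def a_def n_def .
qed

end
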